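(* There is a constant $C$ such that every unit distance graph on a convexly independent set of $n\ge2$ points in the plane has at most $2n\log_2 n + Cn$ edges.
   Context: A finite point set $P\subset\mathbb{R}^2$ is convexly independent if no point of $P$ lies in the convex hull of the other points. The unit distance graph on $P$ has vertex set $P$, with $p,q$ adjacent if and only if $|pq|=1$. *)

theory Defs
  imports "HOL-Analysis.Analysis"
begin

definition convexly_independent :: "(real^2) set \<Rightarrow> bool" where
  "convexly_independent P \<longleftrightarrow> (\<forall>p\<in>P. p \<notin> convex hull (P - {p}))"

definition unit_distance_edges :: "(real^2) set \<Rightarrow> (real^2) set set" where
  "unit_distance_edges P = {{p, q} | p q. p \<in> P \<and> q \<in> P \<and> dist p q = 1}"

end

theory Submission
  imports Defs
begin

text \<open>
  Number the points counterclockwise and view an edge as a pair \<open>(i, j)\<close> with \<open>i < j\<close>. By convexity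
  the angle that the edge makes at \<open>p\<^sub>i\<close> with the polygon is at most a right angle on at least
  one side, which splits the edges into two classes. Elementary angle chasing in isosceles triangles
  shows that the 0-1 matrix of each class, up to reversing its rows or columns, avoids Furedi's
  pattern \<open>(i, j\<^sub>1), (i, j\<^sub>2), (i', j\<^sub>1), (i', j\<^sub>3)\<close> with \<open>i < i'\<close> and \<open>j\<^sub>1 < j\<^sub>2 < j\<^sub>3\<close>.

  For an entry \<open>j\<close> of row \<open>i\<close> let \<open>z\<close> be the next and \<open>w\<close> the last entry of the row. The quantities
  \<open>log ((w - j) / (w - z))\<close> telescope along each row; because the pattern is avoided, the quantities
  \<open>log ((w - j) / (z - j))\<close> telescope along each column. Either sum is at most \<open>log n\<close>, whereas
  every entry contributes at least 2 to the two sums together. So each class has at most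
  \<open>n log n + 2 n\<close> edges.
\<close>

section \<open>A forbidden pattern in 0-1 matrices\<close>

text \<open>This is the telescoping step. After removing the least index \<open>b\<close>, the
  remaining intervals all lie below \<open>g b\<close>, so the induction hypothesis applies with
  \<open>g b\<close> in place of \<open>M\<close>, and \<open>f b - g b\<close> fills the
  rest.\<close>

lemma sum_separated_intervals_le:
  fixes f g :: "'a::linorder \<Rightarrow> real"
  assumes "finite S" and "0 \<le> M"
    and "\<And>i. i \<in> S \<Longrightarrow> f i \<le> M" and "\<And>i. i \<in> S \<Longrightarrow> 0 \<le> g i"
    and "\<And>i i'. i \<in> S \<Longrightarrow> i' \<in> S \<Longrightarrow> i < i' \<Longrightarrow> f i' \<le> g i"
  shows "(\<Sum>i\<in>S. f i - g i) \<le> M"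
  using assms
proof (induction S arbitrary: M rule: finite_linorder_min_induct)
  case empty
  then show ?case by simp
next
  case (insert b A)
  have "(\<Sum>i\<in>A. f i - g i) \<le> g b"
    by (rule insert.IH) (use insert in auto)
  moreover have "b \<notin> A" using insert by blast
  moreover have "f b \<le> M" using insert by blast
  ultimately show ?case using insert.hyps(1) by simp
qed

lemma card_le_if_no_pattern:
  fixes E :: "(nat \<times> nat) set" and n :: nat
  assumes n: "n \<ge> 1" and sub: "E \<subseteq> {..<n} \<times> {..<n}"
    and no_pattern: "\<And>i i' j1 j2 j3. i < i' \<Longrightarrow> j1 < j2 \<Longrightarrow> j2 < j3 \<Longrightarrow> (i, j1) \<in> E \<Longrightarrow>
       (i, j2) \<in> E \<Longrightarrow> (i', j1) \<in> E \<Longrightarrow> (i', j3) \<in> E \<Longrightarrow> False"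
  shows "real (card E) \<le> real n * log 2 (real n) + 2 * real n"
proof -
  \<comment> \<open>\<open>Max\<close> and \<open>Min\<close> are meaningful only on nonempty sets,
    so the facts below speak of \<open>w i\<close> for rows containing an entry and of
    \<open>z i j\<close> when another entry follows \<open>j\<close>.\<close>
  define w where "w i = Max {j. (i, j) \<in> E}" for i
  define z where "z i j = Min {k. (i, k) \<in> E \<and> j < k}" for i j
  have finE: "finite E" using sub finite_subset by blast
  have fin: "finite {j. (i, j) \<in> E}" for i
    by (rule finite_subset[of _ "{..<n}"]) (use sub in auto)
  have fin2: "finite {k. (i, k) \<in> E \<and> j < k}" for i j
    by (rule finite_subset[OF _ fin[of i]]) auto
  have w_in: "(i, w i) \<in> E" and w_ge: "j \<le> w i" if "(i, j) \<in> E" for i j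
    using Max_in[OF fin[of i]] Max_ge[OF fin[of i]] that unfolding w_def by auto
  have z_in: "(i, z i j) \<in> E" and z_gt: "j < z i j" if "(i, j) \<in> E" "j < w i" for i j
    using Min_in[OF fin2[of i j]] w_in[OF that(1)] that(2) unfolding z_def by auto
  have z_le: "z i j \<le> k" if "(i, k) \<in> E" "j < k" for i j k
    unfolding z_def by (rule Min_le[OF fin2]) (use that in auto)
  have bound: "i < n" "j < n" if "(i, j) \<in> E" for i j using that sub by auto

  \<comment> \<open>Keeping only entries followed by at least two others in their row makes
    \<open>w - j\<close>, \<open>w - z\<close> and \<open>z - j\<close> positive integers, so every
    logarithm below is nonnegative.\<close>
  define E' where "E' = {(i, j) \<in> E. j < w i \<and> z i j < w i}"
  have E'E: "E' \<subseteq> E" unfolding E'_def by auto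
  have finE': "finite E'" using E'E finE finite_subset by blast
  have E'D: "(i, j) \<in> E" "j < z i j" "z i j < w i" "w i < n" "(i, w i) \<in> E" "(i, z i j) \<in> E"
    if "(i, j) \<in> E'" for i j
    using that z_gt[of i j] z_in[of i j] w_in[of i j] bound(2)[of i "w i"] unfolding E'_def by auto

  have discarded: "card (E - E') \<le> 2 * n"
  proof -
    \<comment> \<open>Each row loses at most its last entry (\<open>?A\<close>) and its second to
      last entry (\<open>?B\<close>).\<close>
    let ?A = "{(i, j) \<in> E. j = w i}" and ?B = "{(i, j) \<in> E. j < w i \<and> z i j = w i}"
    have *: "E - E' \<subseteq> ?A \<union> ?B"
    proof
      fix e assume e: "e \<in> E - E'"
      obtain i j where ij: "e = (i, j)" by fastforce
      have "(i, j) \<in> E" using e ij by simp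
      then show "e \<in> ?A \<union> ?B"
        using e ij w_ge[of i j] z_le[of i "w i" j] w_in[of i j] unfolding E'_def by force
    qed
    have "inj_on fst ?A" by (auto simp: inj_on_def)
    then have A: "card ?A \<le> n"
      using card_inj_on_le[of fst ?A "{..<n}"] bound(1) by force
    have "j = j'" if "(i, j) \<in> E" "(i, j') \<in> E" "j < w i" "j' < w i" "z i j = w i" "z i j' = w i"
      for i j j'
      using z_le[OF that(1), of j'] z_le[OF that(2), of j] that by (cases j j' rule: linorder_cases) auto
    then have "inj_on fst ?B" by (auto simp: inj_on_def)
    then have B: "card ?B \<le> n"
      using card_inj_on_le[of fst ?B "{..<n}"] bound(1) by force
    have "card (E - E') \<le> card (?A \<union> ?B)"
      by (rule card_mono[OF _ *]) (rule finite_subset[OF _ finE], auto)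
    also have "\<dots> \<le> card ?A + card ?B" by (rule card_Un_le)
    finally show ?thesis using A B by simp
  qed

  let ?M = "log 2 (real n)"
  let ?r = "\<lambda>i j. log 2 (real (w i) - real j) - log 2 (real (w i) - real (z i j))"
  let ?c = "\<lambda>i j. log 2 (real (w i) - real j) - log 2 (real (z i j) - real j)"
  have M0: "0 \<le> ?M" using n by simp
  \<comment> \<open>The entry \<open>j\<close> owns the interval from log (w - z) to log (w - j).
    The next entry \<open>z i j\<close> is at most any later \<open>j'\<close>, which puts the
    interval of \<open>j'\<close> below that of \<open>j\<close>.\<close>
  have row: "(\<Sum>j | (i, j) \<in> E'. ?r i j) \<le> ?M" for i
  proof (rule sum_separated_intervals_le[OF _ M0])
    show "finite {j. (i, j) \<in> E'}"
      by (rule finite_subset[OF _ fin[of i]]) (use E'E in auto)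
  next
    fix j assume "j \<in> {j. (i, j) \<in> E'}"
    note E'D[of i j] this
    then show "log 2 (real (w i) - real j) \<le> ?M" "0 \<le> log 2 (real (w i) - real (z i j))"
      by (auto intro!: log_mono)
  next
    fix j j' assume *: "j \<in> {j. (i, j) \<in> E'}" "j' \<in> {j. (i, j) \<in> E'}" "j < j'"
    then have "z i j \<le> j'" using z_le E'E by blast
    then show "log 2 (real (w i) - real j') \<le> log 2 (real (w i) - real (z i j))"
      using * E'D[of i j] E'D[of i j'] by (auto intro!: log_mono)
  qed
  have col: "(\<Sum>i | (i, j) \<in> E'. ?c i j) \<le> ?M" for j
  proof (rule sum_separated_intervals_le[OF _ M0])
    show "finite {i. (i, j) \<in> E'}"
      by (rule finite_subset[of _ "{..<n}"]) (use E'E sub in auto)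
  next
    fix i assume "i \<in> {i. (i, j) \<in> E'}"
    note E'D[of i j] this
    then show "log 2 (real (w i) - real j) \<le> ?M" "0 \<le> log 2 (real (z i j) - real j)"
      by (auto intro!: log_mono)
  next
    fix i i' assume *: "i \<in> {i. (i, j) \<in> E'}" "i' \<in> {i. (i, j) \<in> E'}" "i < i'"
    \<comment> \<open>Otherwise rows \<open>i\<close>, \<open>i'\<close> and columns
      \<open>j\<close>, \<open>z i j\<close>, \<open>w i'\<close> would form the forbidden pattern.
      This is the only use of its absence.\<close>
    then have "w i' \<le> z i j"
      using no_pattern[of i i' j "z i j" "w i'"] E'D[of i j] E'D[of i' j] by force
    then show "log 2 (real (w i') - real j) \<le> log 2 (real (z i j) - real j)"
      using * E'D[of i j] E'D[of i' j] by (auto intro!: log_mono)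
  qed
  \<comment> \<open>AM-GM: the point z splits [j, w] into two parts whose product is at most a quarter of the
    squared length.\<close>
  have two: "2 \<le> ?r i j + ?c i j" if "(i, j) \<in> E'" for i j
  proof -
    define x y where "x = real (w i) - real (z i j)" and "y = real (z i j) - real j"
    have pos: "x > 0" "y > 0" using E'D[OF that] by (auto simp: x_def y_def)
    have "4 * (x * y) \<le> (x + y)\<^sup>2"
      using zero_le_power2[of "x - y"] by (simp add: power2_eq_square algebra_simps)
    then have "log 2 (4 * (x * y)) \<le> log 2 ((x + y)\<^sup>2)" using pos by (intro log_mono) auto
    moreover have "log 2 (4 * (x * y)) = 2 + log 2 x + log 2 y"
      using pos log_pow_cancel[of 2 2] by (simp add: log_mult)
    moreover have "log 2 ((x + y)\<^sup>2) = 2 * log 2 (x + y)" using pos by (simp add: log_nat_power)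
    moreover have "x + y = real (w i) - real j" by (simp add: x_def y_def)
    ultimately have "2 \<le> (log 2 (real (w i) - real j) - log 2 x) + (log 2 (real (w i) - real j) - log 2 y)"
      by simp
    then show ?thesis unfolding x_def y_def .
  qed
  have E'_Sigma: "E' = Sigma {..<n} (\<lambda>i. {j. (i, j) \<in> E'})"
    using E'E sub by auto
  have E'_swap: "E' = prod.swap ` Sigma {..<n} (\<lambda>j. {i. (i, j) \<in> E'})"
    using E'E sub by force
  have finr: "finite {j. (i, j) \<in> E'}" for i
    by (rule finite_subset[OF _ fin[of i]]) (use E'E in auto)
  have finc: "finite {i. (i, j) \<in> E'}" for j
    by (rule finite_subset[of _ "{..<n}"]) (use E'E sub in auto)
  have "(\<Sum>(i, j)\<in>E'. ?r i j) = (\<Sum>i<n. \<Sum>j | (i, j) \<in> E'. ?r i j)"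
    by (subst E'_Sigma, subst sum.Sigma[symmetric]) (use finr in auto)
  also have "\<dots> \<le> (\<Sum>i<n. ?M)" by (rule sum_mono) (rule row)
  finally have R: "(\<Sum>(i, j)\<in>E'. ?r i j) \<le> real n * ?M" by simp
  have "(\<Sum>(i, j)\<in>E'. ?c i j) = (\<Sum>(j, i)\<in>Sigma {..<n} (\<lambda>j. {i. (i, j) \<in> E'}). ?c i j)"
    by (subst E'_swap, subst sum.reindex) (auto simp: inj_on_def intro!: sum.cong)
  also have "\<dots> = (\<Sum>j<n. \<Sum>i | (i, j) \<in> E'. ?c i j)"
    by (subst sum.Sigma[symmetric]) (use finc in auto)
  also have "\<dots> \<le> (\<Sum>j<n. ?M)" by (rule sum_mono) (rule col)
  finally have C: "(\<Sum>(i, j)\<in>E'. ?c i j) \<le> real n * ?M" by simp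
  have "2 * real (card E') = (\<Sum>(i, j)\<in>E'. 2)" by simp
  also have "\<dots> \<le> (\<Sum>(i, j)\<in>E'. ?r i j + ?c i j)"
    by (rule sum_mono) (use two in auto)
  also have "\<dots> = (\<Sum>(i, j)\<in>E'. ?r i j) + (\<Sum>(i, j)\<in>E'. ?c i j)"
    unfolding case_prod_beta by (rule sum.distrib)
  finally have "real (card E') \<le> real n * ?M" using R C by linarith
  moreover have "card E = card E' + card (E - E')"
    using E'E finE by (metis card_Diff_subset card_mono finE' le_add_diff_inverse)
  ultimately show ?thesis using discarded by linarith
qed

section \<open>Convex position\<close>

text \<open>Twice the signed area of the triangle, as a polynomial in the coordinates so that
  orientation arguments become polynomial identities.\<close>

definition ccw :: "real^2 \<Rightarrow> real^2 \<Rightarrow> real^2 \<Rightarrow> real" where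
  "ccw p q r = (q$1 - p$1) * (r$2 - p$2) - (q$2 - p$2) * (r$1 - p$1)"

text \<open>The order properties are required on \<open>S\<close> alone because the angular order
  used below is transitive and total only on the points other than its centre. The proof is
  insertion sort.\<close>

lemma exists_sorted_wrt:
  assumes "finite S" and "\<And>x y z. x \<in> S \<Longrightarrow> y \<in> S \<Longrightarrow> z \<in> S \<Longrightarrow> r x y \<Longrightarrow> r y z \<Longrightarrow> r x z"
    and "\<And>x y. x \<in> S \<Longrightarrow> y \<in> S \<Longrightarrow> x \<noteq> y \<Longrightarrow> r x y \<or> r y x"
  shows "\<exists>xs. set xs = S \<and> distinct xs \<and> sorted_wrt r xs"
  using assms
proof (induction S rule: finite_induct)
  case empty
  then show ?case by simp
next
  case (insert x S)
  have "\<exists>xs. set xs = S \<and> distinct xs \<and> sorted_wrt r xs"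
    by (rule insert.IH) (use insert.prems in blast)+
  then obtain xs where xs: "set xs = S" "distinct xs" "sorted_wrt r xs" by blast
  let ?ys = "filter (\<lambda>y. r y x) xs @ x # filter (\<lambda>y. \<not> r y x) xs"
  have "r x y" if "y \<in> S" "\<not> r y x" for y
    using that insert.prems(2)[of x y] insert.hyps(2) by auto
  then have "sorted_wrt r ?ys"
    using xs insert.prems(1) by (auto simp: sorted_wrt_append sorted_wrt_filter)
  moreover have "set ?ys = insert x S" using xs by auto
  moreover have "distinct ?ys" using xs insert.hyps by auto
  ultimately show ?case by blast
qed

text \<open>The three areas spanned by \<open>d\<close> and the sides, divided by the area of the
  whole triangle, are the barycentric coordinates of \<open>d\<close>.\<close>

lemma in_convex_hull_triangle:
  assumes "ccw a b c > 0" "ccw a b d \<ge> 0" "ccw b c d \<ge> 0" "ccw c a d \<ge> 0"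
  shows "d \<in> convex hull {a, b, c}"
proof -
  let ?D = "ccw a b c"
  have sum: "ccw b c d + ccw c a d + ccw a b d = ?D" by (simp add: ccw_def algebra_simps)
  have "?D *\<^sub>R d = ccw b c d *\<^sub>R a + ccw c a d *\<^sub>R b + ccw a b d *\<^sub>R c"
    by (simp add: vec_eq_iff forall_2 ccw_def algebra_simps)
  then have "inverse ?D *\<^sub>R (?D *\<^sub>R d)
      = inverse ?D *\<^sub>R (ccw b c d *\<^sub>R a + ccw c a d *\<^sub>R b + ccw a b d *\<^sub>R c)" by simp
  then have "d = (ccw b c d / ?D) *\<^sub>R a + (ccw c a d / ?D) *\<^sub>R b + (ccw a b d / ?D) *\<^sub>R c"
    using assms(1) by (simp add: scaleR_right_distrib divide_inverse mult.commute)
  moreover have "ccw b c d / ?D + ccw c a d / ?D + ccw a b d / ?D = 1"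
    using sum assms(1) by (simp add: add_divide_distrib[symmetric])
  ultimately show ?thesis
    unfolding convex_hull_3 using assms by (smt (verit) divide_nonneg_pos mem_Collect_eq)
qed

lemma convexly_independentD:
  assumes "convexly_independent P" "p \<in> P" "S \<subseteq> P" "p \<notin> S"
  shows "p \<notin> convex hull S"
  using assms hull_mono[of S "P - {p}" convex] unfolding convexly_independent_def by blast

text \<open>Triples through the first point \<open>v\<close> are positively oriented by the sorting.
  A failure at any other triple would put its middle point into the triangle of \<open>v\<close> and
  the other two points.\<close>

lemma convexly_independent_ccw_enumeration:
  fixes P :: "(real^2) set"
  assumes fin: "finite P" and ne: "P \<noteq> {}" and ci: "convexly_independent P"
  obtains p where "bij_betw p {..<card P} P"
    and "\<And>i j k. i < j \<Longrightarrow> j < k \<Longrightarrow> k < card P \<Longrightarrow> ccw (p i) (p j) (p k) > 0"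
proof -
  \<comment> \<open>Sort by angle around the lexicographically smallest point v.\<close>
  obtain v where vP: "v \<in> P"
    and v_min: "\<And>q. q \<in> P \<Longrightarrow> q \<noteq> v \<Longrightarrow> v$1 < q$1 \<or> (v$1 = q$1 \<and> v$2 < q$2)"
  proof -
    define m where "m = Min ((\<lambda>q. q$1) ` P)"
    have m: "m \<in> (\<lambda>q. q$1) ` P" "\<And>q. q \<in> P \<Longrightarrow> m \<le> q$1"
      unfolding m_def using fin ne by auto
    let ?Q = "{q \<in> P. q$1 = m}"
    have Q: "finite ?Q" "?Q \<noteq> {}" using fin m(1) by auto
    have "Min ((\<lambda>q. q$2) ` ?Q) \<in> (\<lambda>q. q$2) ` ?Q" using Q by (intro Min_in) auto
    then obtain v where v: "v \<in> ?Q" "v$2 = Min ((\<lambda>q. q$2) ` ?Q)" by auto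
    have "v$1 < q$1 \<or> (v$1 = q$1 \<and> v$2 < q$2)" if q: "q \<in> P" "q \<noteq> v" for q
    proof (cases "q$1 = m")
      case True
      then have "v$2 \<le> q$2" using v(2) Q q by simp
      moreover have "v$2 \<noteq> q$2" using q(2) True v(1) by (auto simp: vec_eq_iff forall_2)
      ultimately show ?thesis using True v(1) by simp
    next
      case False
      then show ?thesis using m(2)[OF q(1)] v(1) by simp
    qed
    then show thesis using that v(1) by blast
  qed
  let ?r = "\<lambda>q r. ccw v q r > 0"
  have tr: "?r q s" if "q \<in> P - {v}" "r \<in> P - {v}" "s \<in> P - {v}" "?r q r" "?r r s" for q r s
  proof -
    define q1 q2 r1 r2 s1 s2 where d: "q1 = q$1 - v$1" "q2 = q$2 - v$2" "r1 = r$1 - v$1"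
      "r2 = r$2 - v$2" "s1 = s$1 - v$1" "s2 = s$2 - v$2"
    have h: "0 < q1 \<or> (q1 = 0 \<and> 0 < q2)" "0 < r1 \<or> (r1 = 0 \<and> 0 < r2)" "0 < s1 \<or> (s1 = 0 \<and> 0 < s2)"
      using v_min[of q] v_min[of r] v_min[of s] that by (auto simp: d)
    have c: "q1 * r2 - q2 * r1 > 0" "r1 * s2 - r2 * s1 > 0"
      using that by (auto simp: ccw_def d)
    \<comment> \<open>Scaling by \<open>r1\<close> expresses the goal through the two known cross
      products. Only the last of the three directions can be vertical, hence \<open>r1\<close> and
      \<open>q1\<close> are positive.\<close>
    have id: "r1 * (q1 * s2 - q2 * s1) = q1 * (r1 * s2 - r2 * s1) + s1 * (q1 * r2 - q2 * r1)"
      by algebra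
    have r1: "r1 > 0"
    proof (rule ccontr)
      assume "\<not> r1 > 0"
      then have "r1 = 0" "0 < r2" using h by auto
      then show False using c(2) h(3) by (auto simp: zero_less_mult_iff mult_less_0_iff)
    qed
    have q1: "q1 > 0"
    proof (rule ccontr)
      assume "\<not> q1 > 0"
      then have "q1 = 0" "0 < q2" using h by auto
      then show False using c(1) r1 by (auto simp: zero_less_mult_iff mult_less_0_iff)
    qed
    have "r1 * (q1 * s2 - q2 * s1) > 0"
      unfolding id using q1 c h(3) by (intro add_pos_nonneg mult_pos_pos mult_nonneg_nonneg) auto
    then have "q1 * s2 - q2 * s1 > 0" using r1 by (simp add: zero_less_mult_iff)
    then show ?thesis by (simp add: ccw_def d)
  qed
  have on_ray: "q = (1 - u) *\<^sub>R v + u *\<^sub>R r"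
    if "q$1 - v$1 = u * (r$1 - v$1)" "q$2 - v$2 = u * (r$2 - v$2)" for q r :: "real^2" and u
    using that by (simp add: vec_eq_iff forall_2 algebra_simps)
  have not_on_segment: False
    if "q \<in> P - {v}" "r \<in> P - {v}" "q \<noteq> r" "q$1 - v$1 = u * (r$1 - v$1)" "q$2 - v$2 = u * (r$2 - v$2)"
      "0 \<le> u" "u \<le> 1" for q r u
  proof -
    have "q \<in> closed_segment v r"
      unfolding closed_segment_def using on_ray[OF that(4,5)] that(6,7) by blast
    then have "q \<in> convex hull {v, r}" by (simp add: segment_convex_hull)
    moreover have "q \<notin> convex hull {v, r}"
      by (rule convexly_independentD[OF ci]) (use that vP in auto)
    ultimately show False by blast
  qed
  have tot: "?r q r \<or> ?r r q" if "q \<in> P - {v}" "r \<in> P - {v}" "q \<noteq> r" for q r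
  proof (rule ccontr)
    assume "\<not> (?r q r \<or> ?r r q)"
    then have z: "(q$1 - v$1) * (r$2 - v$2) = (q$2 - v$2) * (r$1 - v$1)"
      by (simp add: ccw_def algebra_simps)
    have hq: "0 < q$1 - v$1 \<or> (q$1 - v$1 = 0 \<and> 0 < q$2 - v$2)"
      and hr: "0 < r$1 - v$1 \<or> (r$1 - v$1 = 0 \<and> 0 < r$2 - v$2)"
      using v_min[of q] v_min[of r] that by auto
    \<comment> \<open>Incomparable points are collinear with \<open>v\<close>, and by minimality of
      \<open>v\<close> on the same side of it. The ratio \<open>u\<close> is read off the first
      coordinate, or off the second on a vertical ray; whichever point is nearer to \<open>v\<close>
      then lies on the segment from \<open>v\<close> to the other.\<close>
    have "\<exists>u>0. q$1 - v$1 = u * (r$1 - v$1) \<and> q$2 - v$2 = u * (r$2 - v$2)"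
    proof (cases "r$1 - v$1 > 0")
      case True
      then have "q$1 - v$1 \<noteq> 0" using z hq by auto
      then have "(q$1 - v$1) / (r$1 - v$1) > 0" using hq True by auto
      moreover have "q$2 - v$2 = (q$1 - v$1) / (r$1 - v$1) * (r$2 - v$2)"
        using z True by (simp add: field_simps)
      ultimately show ?thesis using True by (intro exI[of _ "(q$1 - v$1) / (r$1 - v$1)"]) auto
    next
      case False
      then have r0: "r$1 - v$1 = 0" "r$2 - v$2 > 0" using hr by auto
      then have "q$1 - v$1 = 0" using z by auto
      then show ?thesis using hq r0 by (intro exI[of _ "(q$2 - v$2) / (r$2 - v$2)"]) auto
    qed
    then obtain u where u: "u > 0" "q$1 - v$1 = u * (r$1 - v$1)" "q$2 - v$2 = u * (r$2 - v$2)"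
      by blast
    show False
    proof (cases "u \<le> 1")
      case True
      then show False using not_on_segment[OF that u(2,3)] u(1) by simp
    next
      case False
      have "r$1 - v$1 = (1 / u) * (q$1 - v$1)" "r$2 - v$2 = (1 / u) * (q$2 - v$2)"
        using u by auto
      then show False using not_on_segment[OF that(2,1), of "1 / u"] that(3) False by auto
    qed
  qed
  obtain xs where xs: "set xs = P - {v}" "distinct xs" "sorted_wrt ?r xs"
    using exists_sorted_wrt[of "P - {v}" ?r] fin tr tot by blast
  let ?ys = "v # xs"
  have ys: "set ?ys = P" "distinct ?ys" using xs vP by auto
  then have len: "length ?ys = card P" using distinct_card by metis
  have "bij_betw (\<lambda>i. ?ys ! i) {..<card P} P"
    by (rule bij_betw_nth[OF ys(2)]) (simp_all only: len ys(1))
  moreover have "ccw (?ys ! i) (?ys ! j) (?ys ! k) > 0" if "i < j" "j < k" "k < card P" for i j k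
  proof -
    \<comment> \<open>Position 0 of \<open>?ys\<close> is \<open>v\<close>, so positive positions
      are shifted by one against \<open>xs\<close>.\<close>
    have jk: "j - 1 < k - 1" "k - 1 < length xs" using that len by auto
    have rjk: "?r (?ys ! j) (?ys ! k)"
      using sorted_wrt_nth_less[OF xs(3) jk] that by (simp add: nth_Cons')
    show ?thesis
    proof (cases "i = 0")
      case True
      then show ?thesis using rjk by simp
    next
      case False
      have rij: "?r (?ys ! i) (?ys ! j)"
        using sorted_wrt_nth_less[OF xs(3), of "i - 1" "j - 1"] that jk False by (simp add: nth_Cons')
      have rik: "?r (?ys ! i) (?ys ! k)"
        using sorted_wrt_nth_less[OF xs(3), of "i - 1" "k - 1"] that jk False by (simp add: nth_Cons')
      have neq: "?ys ! j \<noteq> v" "?ys ! j \<noteq> ?ys ! i" "?ys ! j \<noteq> ?ys ! k"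
      proof -
        have "?ys ! j \<noteq> ?ys ! m" if "m < card P" "m \<noteq> j" for m
          using nth_eq_iff_index_eq[OF ys(2), of j m] that len \<open>j < k\<close> \<open>k < card P\<close> by simp
        from this[of 0] this[of i] this[of k] show "?ys ! j \<noteq> v" "?ys ! j \<noteq> ?ys ! i" "?ys ! j \<noteq> ?ys ! k"
          using that by auto
      qed
      have inP: "?ys ! m \<in> P" if "m < card P" for m
        using that len ys(1) nth_mem[of m ?ys] by auto
      show ?thesis
      proof (rule ccontr)
        assume neg: "\<not> ?thesis"
        have "?ys ! j \<in> convex hull {v, ?ys ! i, ?ys ! k}"
        proof (rule in_convex_hull_triangle[OF rik])
          show "ccw v (?ys ! i) (?ys ! j) \<ge> 0" using rij by simp
          show "ccw (?ys ! i) (?ys ! k) (?ys ! j) \<ge> 0" using neg by (simp add: ccw_def algebra_simps)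
          show "ccw (?ys ! k) v (?ys ! j) \<ge> 0" using rjk by (simp add: ccw_def algebra_simps)
        qed
        moreover have "?ys ! j \<notin> convex hull {v, ?ys ! i, ?ys ! k}"
          by (rule convexly_independentD[OF ci]) (use neq inP[of i] inP[of j] inP[of k] that vP in auto)
        ultimately show False by blast
      qed
    qed
  qed
  ultimately show thesis using that by blast
qed

section \<open>Unit distances in convex position\<close>

text \<open>Put c = cos x, s = sin x, p = sin 2y, q = 2 (cos y)^2 with 0 < x < pi and 0 < y < pi/2.
  Then \<open>acute\<close> says x + y < pi/2, and the claim reads cos (x + 2y) < cos 2y, which
  holds since 2y < x + 2y < 2 pi - 2y.\<close>

lemma trigonometric_core:
  fixes c s p q :: real
  assumes s: "s > 0" and p: "p > 0" and cs: "c\<^sup>2 + s\<^sup>2 = 1" and pq: "p\<^sup>2 + q\<^sup>2 = 2 * q"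
    and acute: "s * p < c * q"
  shows "(1 - c) * (1 - q) < s * p"
proof (rule ccontr)
  assume "\<not> ?thesis"
  then have neg: "s * p \<le> (1 - c) * (1 - q)" by simp
  have sp: "s * p > 0" using s p by simp
  have "2 * q > 0" using pq p by (metis add_pos_nonneg zero_le_power2 zero_less_power)
  then have q: "q > 0" by simp
  have c0: "c > 0" using acute sp q by (metis less_trans zero_less_mult_pos2)
  have "c\<^sup>2 < 1\<^sup>2" using cs s by (smt (verit) one_power2 zero_less_power)
  then have c1: "c < 1" by (rule power_less_imp_less_base) simp
  have q1: "q < 1" using neg sp c1 by (smt (verit) mult_nonneg_nonpos)
  \<comment> \<open>Squaring the negated claim leads to \<open>A\<close>, squaring
    \<open>acute\<close> leads to \<open>B\<close>. With (1 - q)^2 \<le> 1 - q and c^2 < c they give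
    1 + c < 4c - 2, that is c > 1.\<close>
  have "(s * p)\<^sup>2 \<le> ((1 - c) * (1 - q))\<^sup>2" using neg sp by (intro power_mono) auto
  moreover have s2: "s\<^sup>2 = (1 - c) * (1 + c)" using cs by (simp add: power2_eq_square algebra_simps)
  moreover have p2: "p\<^sup>2 = q * (2 - q)" using pq by (simp add: power2_eq_square algebra_simps)
  ultimately have "((1 - c) * (1 + c)) * (q * (2 - q)) \<le> (1 - c)\<^sup>2 * (1 - q)\<^sup>2"
    by (simp add: power_mult_distrib)
  then have "(1 - c) * ((1 + c) * (q * (2 - q))) \<le> (1 - c) * ((1 - c) * (1 - q)\<^sup>2)"
    by (simp only: power2_eq_square[of "1 - c"] mult.assoc)
  then have "(1 + c) * (q * (2 - q)) \<le> (1 - c) * (1 - q)\<^sup>2" using c1 by simp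
  then have A: "1 + c \<le> 2 * (1 - q)\<^sup>2" by (simp add: power2_eq_square algebra_simps)
  have "(s * p)\<^sup>2 < (c * q)\<^sup>2" using acute sp by (intro power_strict_mono) auto
  moreover have "(s * p)\<^sup>2 = q * ((1 - c\<^sup>2) * (2 - q))"
    unfolding power_mult_distrib s2 p2 by (simp add: power2_eq_square algebra_simps)
  ultimately have "q * ((1 - c\<^sup>2) * (2 - q)) < q * (c\<^sup>2 * q)"
    by (simp add: power2_eq_square ac_simps)
  then have "(1 - c\<^sup>2) * (2 - q) < c\<^sup>2 * q" using q by simp
  then have B: "1 - q < 2 * c\<^sup>2 - 1" by (simp add: algebra_simps)
  have "(1 - q)\<^sup>2 \<le> 1 - q" using q q1 by (simp add: power2_eq_square mult_left_le)
  moreover have "c\<^sup>2 < c" using c0 c1 by (simp add: power2_eq_square)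
  ultimately show False using A B c1 by linarith
qed

text \<open>Seen from the origin O, the points a, c, d, e come in counterclockwise order; Oae is
  isosceles with apex a, Ocd with apex c, and Oa, Oc are unit. Let x be the angle from a to c and y
  that from c to d. The base angle of Oae at O is acute, so x + y < pi/2. The two angles at c add up
  to (pi/2 - x/2) + (pi - 2y), which lies strictly between pi/2 and 3 pi/2.\<close>

lemma isosceles_core:
  fixes a1 a2 c1 c2 d1 d2 e1 e2 :: real
  assumes a: "a1\<^sup>2 + a2\<^sup>2 = 1" and c: "c1\<^sup>2 + c2\<^sup>2 = 1"
    and d: "(d1 - c1)\<^sup>2 + (d2 - c2)\<^sup>2 = 1" and e: "(e1 - a1)\<^sup>2 + (e2 - a2)\<^sup>2 = 1"
    and ac: "a1 * c2 - a2 * c1 > 0" and cd: "c1 * d2 - c2 * d1 > 0" and de: "d1 * e2 - d2 * e1 > 0"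
    and ad: "a1 * d2 - a2 * d1 > 0" and ae: "a1 * e2 - a2 * e1 > 0"
  shows "(a1 - c1) * (d1 - c1) + (a2 - c2) * (d2 - c2) < 0"
proof -
  have e_norm: "e1\<^sup>2 + e2\<^sup>2 = 2 * (a1 * e1 + a2 * e2)"
    using e a by (simp add: power2_eq_square algebra_simps)
  have "e1 \<noteq> 0 \<or> e2 \<noteq> 0" using ae by auto
  then have ae_pos: "a1 * e1 + a2 * e2 > 0"
    using e_norm by (smt (verit) zero_le_power2 zero_less_power2)
  \<comment> \<open>Direction d lies between a and e, so it inherits the acute angle with a; the
    identity expresses this through cross and dot products.\<close>
  have "(a1 * e2 - a2 * e1) * (a1 * d1 + a2 * d2)
      = (a1 * d2 - a2 * d1) * (a1 * e1 + a2 * e2) + (d1 * e2 - d2 * e1) * (a1\<^sup>2 + a2\<^sup>2)"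
    by algebra
  also have "\<dots> > 0" using ad ae_pos de a by (simp add: add_pos_pos)
  finally have ad_pos: "a1 * d1 + a2 * d2 > 0" using ae by (simp add: zero_less_mult_iff)
  let ?c = "a1 * c1 + a2 * c2" and ?s = "a1 * c2 - a2 * c1"
    and ?p = "c1 * d2 - c2 * d1" and ?q = "c1 * d1 + c2 * d2"
  have dot: "?c * ?q - ?s * ?p = (a1 * d1 + a2 * d2) * (c1\<^sup>2 + c2\<^sup>2)" by algebra
  have "?c\<^sup>2 + ?s\<^sup>2 = (a1\<^sup>2 + a2\<^sup>2) * (c1\<^sup>2 + c2\<^sup>2)" by algebra
  then have 1: "?c\<^sup>2 + ?s\<^sup>2 = 1" using a c by simp
  have "?p\<^sup>2 + ?q\<^sup>2 = (c1\<^sup>2 + c2\<^sup>2) * (d1\<^sup>2 + d2\<^sup>2)" by algebra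
  moreover have "d1\<^sup>2 + d2\<^sup>2 = 2 * ?q" using d c by (simp add: power2_eq_square algebra_simps)
  ultimately have 2: "?p\<^sup>2 + ?q\<^sup>2 = 2 * ?q" using c by simp
  have "(1 - ?c) * (1 - ?q) < ?s * ?p"
    by (rule trigonometric_core[OF ac cd 1 2]) (use dot ad_pos c in simp)
  moreover have "(a1 - c1) * (d1 - c1) + (a2 - c2) * (d2 - c2)
     = (a1 * d1 + a2 * d2) - ?c - ?q + (c1\<^sup>2 + c2\<^sup>2)"
    by (simp add: power2_eq_square algebra_simps)
  ultimately show ?thesis using dot c by (simp add: algebra_simps)
qed

lemma inner_real2: "(x::real^2) \<bullet> y = x$1 * y$1 + x$2 * y$2"
  by (simp add: inner_vec_def sum_2)

lemma dist_eq_1_real2: "dist (x::real^2) y = 1 \<longleftrightarrow> (x$1 - y$1)\<^sup>2 + (x$2 - y$2)\<^sup>2 = 1"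
  by (simp add: dist_norm norm_eq_sqrt_inner inner_real2 power2_eq_square)

text \<open>The four unit distances are the four entries of the forbidden pattern. With
  \<open>e\<close> moved to the origin, \<open>a\<close>, \<open>b\<close>, \<open>d\<close>,
  \<open>c\<close> take the roles of a, c, d, e in \<open>isosceles_core\<close>.\<close>

lemma obtuse_angle_left:
  assumes "dist a e = 1" "dist a c = 1" "dist b e = 1" "dist b d = 1"
    and "ccw e a b > 0" "ccw e b d > 0" "ccw e d c > 0" "ccw e a d > 0" "ccw e a c > 0"
  shows "(a - b) \<bullet> (d - b) < 0"
  using isosceles_core[of "a$1 - e$1" "a$2 - e$2" "b$1 - e$1" "b$2 - e$2"
      "d$1 - e$1" "d$2 - e$2" "c$1 - e$1" "c$2 - e$2"] assms
  by (simp add: inner_real2 dist_eq_1_real2 ccw_def power2_commute)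

text \<open>The mirror image of \<open>obtuse_angle_left\<close>: negating the first coordinate
  reverses all orientations.\<close>

lemma obtuse_angle_right:
  assumes "dist a e = 1" "dist a c = 1" "dist b e = 1" "dist b d = 1"
    and "ccw e a b < 0" "ccw e b d < 0" "ccw e d c < 0" "ccw e a d < 0" "ccw e a c < 0"
  shows "(a - b) \<bullet> (d - b) < 0"
  using isosceles_core[of "e$1 - a$1" "a$2 - e$2" "e$1 - b$1" "b$2 - e$2"
      "e$1 - d$1" "d$2 - e$2" "e$1 - c$1" "c$2 - e$2"] assms
  by (simp add: inner_real2 dist_eq_1_real2 ccw_def power2_commute algebra_simps)

lemma ccw_rotate: "ccw p q r = ccw q r p"
  by (simp add: ccw_def algebra_simps)

text \<open>The ray from \<open>i\<close> to \<open>j\<close> runs inside the angle at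
  \<open>i\<close> between \<open>l\<close> and \<open>k\<close>, which is less than pi, so its two
  parts cannot both exceed pi/2. The identity used is the addition formula for the sine, without
  denominators.\<close>

lemma not_both_obtuse:
  assumes "ccw k i j > 0" "ccw i l j > 0" "ccw k i l > 0"
    and K: "(k - i) \<bullet> (j - i) < 0" and L: "(l - i) \<bullet> (j - i) < 0"
  shows False
proof -
  have pos: "ccw i j k > 0" "ccw i l k > 0" "ccw i l j > 0" using assms ccw_rotate by metis+
  have "((j - i) \<bullet> (j - i)) * ccw i l k
      = ((l - i) \<bullet> (j - i)) * ccw i j k + ccw i l j * ((k - i) \<bullet> (j - i))"
    unfolding inner_real2 ccw_def by simp algebra
  moreover have "((l - i) \<bullet> (j - i)) * ccw i j k < 0" "ccw i l j * ((k - i) \<bullet> (j - i)) < 0"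
    using pos K L by (auto simp: mult_less_0_iff)
  moreover have "((j - i) \<bullet> (j - i)) * ccw i l k \<ge> 0" using pos by simp
  ultimately show False by linarith
qed

section \<open>Counting the edges by two matrices\<close>

lemma card_unit_distance_edges_le:
  assumes fin: "finite P" and card: "card P \<ge> 1" and ci: "convexly_independent P"
  shows "real (card (unit_distance_edges P))
    \<le> 2 * real (card P) * log 2 (real (card P)) + 4 * real (card P)"
proof -
  define n where "n = card P"
  obtain p where bij: "bij_betw p {..<n} P"
    and ccw: "\<And>i j k. i < j \<Longrightarrow> j < k \<Longrightarrow> k < n \<Longrightarrow> ccw (p i) (p j) (p k) > 0"
    unfolding n_def
  proof (rule convexly_independent_ccw_enumeration[OF fin _ ci])
    show "P \<noteq> {}" using card by auto
  qed blast
  have ccw_neg: "ccw (p i) (p k) (p j) < 0" if "i < j" "j < k" "k < n" for i j k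
    using ccw[OF that] by (simp add: ccw_def algebra_simps)
  define U where "U = {(i, j). i < j \<and> j < n \<and> dist (p i) (p j) = 1}"
  let ?acute = "\<lambda>i j k. (p k - p i) \<bullet> (p j - p i) \<ge> 0"
  \<comment> \<open>For i < j, the vertices before \<open>i\<close> and those strictly between
    \<open>i\<close> and \<open>j\<close> lie on opposite sides of the edge. \<open>E1\<close> and
    \<open>E2\<close> collect the edges making no obtuse angle at \<open>i\<close> with any vertex
    of the first, respectively the second, kind.\<close>
  define E1 where "E1 = {(i, j) \<in> U. \<forall>k<i. ?acute i j k}"
  define E2 where "E2 = {(i, j) \<in> U. \<forall>k. i < k \<and> k < j \<longrightarrow> ?acute i j k}"
  have Usub: "U \<subseteq> {..<n} \<times> {..<n}" unfolding U_def by auto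
  then have finU: "finite U" using finite_subset by blast
  have U12: "U = E1 \<union> E2"
  proof -
    have "?acute i j k \<or> ?acute i j l" if "(i, j) \<in> U" "k < i" "i < l" "l < j" for i j k l
    proof -
      have "j < n" using that(1) unfolding U_def by simp
      then show ?thesis
        using not_both_obtuse[of "p k" "p i" "p j" "p l"] ccw[of k i j] ccw[of i l j] ccw[of k i l]
          that by (meson less_trans not_le)
    qed
    then show ?thesis unfolding E1_def E2_def by blast
  qed
  have n1: "n \<ge> 1" using card n_def by simp
  let ?rev = "\<lambda>i. n - 1 - i"
  \<comment> \<open>Reversing the columns turns the common column of the pattern into the largest
    index \<open>e\<close>, giving i < i' < d < c < e. The angle at \<open>i'\<close> towards
    \<open>i\<close> and \<open>d\<close> is then obtuse, against (i', d) in
    \<open>E1\<close>.\<close>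
  have "real (card ((\<lambda>(i, j). (i, ?rev j)) ` E1)) \<le> real n * log 2 (real n) + 2 * real n"
  proof (rule card_le_if_no_pattern[OF n1])
    show "(\<lambda>(i, j). (i, ?rev j)) ` E1 \<subseteq> {..<n} \<times> {..<n}"
      unfolding E1_def U_def by auto
  next
    fix i i' j1 j2 j3 :: nat
    let ?E = "(\<lambda>(i, j). (i, ?rev j)) ` E1"
    assume lt: "i < i'" "j1 < j2" "j2 < j3"
      and "(i, j1) \<in> ?E" "(i, j2) \<in> ?E" "(i', j1) \<in> ?E" "(i', j3) \<in> ?E"
    \<comment> \<open>Truncated subtraction makes \<open>?rev\<close> an order-reversing involution
      only below \<open>n\<close>, so the bound on \<open>y\<close> is carried along.\<close>
    moreover have "(x, ?rev y) \<in> E1 \<and> y < n" if "(x, y) \<in> ?E" for x y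
      using that unfolding E1_def U_def by (auto simp: Suc_diff_Suc)
    ultimately have E: "(i, ?rev j1) \<in> E1" "(i, ?rev j2) \<in> E1" "(i', ?rev j1) \<in> E1"
      "(i', ?rev j3) \<in> E1" and "j3 < n" by blast+
    define e c d where "e = ?rev j1" and "c = ?rev j2" and "d = ?rev j3"
    have v: "i < i'" "i' < d" "d < c" "c < e" "e < n"
      using lt E \<open>j3 < n\<close> unfolding e_def c_def d_def E1_def U_def by auto
    have "(p i - p i') \<bullet> (p d - p i') < 0"
    proof (rule obtuse_angle_left)
      show "dist (p i) (p e) = 1" "dist (p i) (p c) = 1" "dist (p i') (p e) = 1" "dist (p i') (p d) = 1"
        using E unfolding e_def c_def d_def E1_def U_def by auto
      show "ccw (p e) (p i) (p i') > 0" "ccw (p e) (p i') (p d) > 0" "ccw (p e) (p d) (p c) > 0"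
        "ccw (p e) (p i) (p d) > 0" "ccw (p e) (p i) (p c) > 0"
        using v by (auto simp: ccw_rotate[of "p e"] intro!: ccw)
    qed
    moreover have "?acute i' d i" using E(4) lt(1) unfolding d_def E1_def by auto
    ultimately show False by simp
  qed
  moreover have "inj_on (\<lambda>(i, j). (i, ?rev j)) E1"
    unfolding E1_def U_def inj_on_def by auto
  ultimately have c1: "real (card E1) \<le> real n * log 2 (real n) + 2 * real n"
    by (simp add: card_image)
  \<comment> \<open>Here the rows are reversed, so b < a < e < c < d and the points appear clockwise
    from \<open>e\<close>. The angle at \<open>b\<close> towards \<open>a\<close> and
    \<open>d\<close> is obtuse although \<open>a\<close> lies between \<open>b\<close> and
    \<open>d\<close>, against (b, d) in \<open>E2\<close>.\<close>
  have "real (card ((\<lambda>(i, j). (?rev i, j)) ` E2)) \<le> real n * log 2 (real n) + 2 * real n"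
  proof (rule card_le_if_no_pattern[OF n1])
    show "(\<lambda>(i, j). (?rev i, j)) ` E2 \<subseteq> {..<n} \<times> {..<n}"
      unfolding E2_def U_def by auto
  next
    fix i i' e c d :: nat
    let ?E = "(\<lambda>(i, j). (?rev i, j)) ` E2"
    assume lt: "i < i'" "e < c" "c < d"
      and "(i, e) \<in> ?E" "(i, c) \<in> ?E" "(i', e) \<in> ?E" "(i', d) \<in> ?E"
    moreover have "(?rev x, y) \<in> E2 \<and> x < n" if "(x, y) \<in> ?E" for x y
      using that unfolding E2_def U_def by (auto simp: Suc_diff_Suc)
    ultimately have E: "(?rev i, e) \<in> E2" "(?rev i, c) \<in> E2" "(?rev i', e) \<in> E2"
      "(?rev i', d) \<in> E2" and "i' < n" by blast+
    define a b where "a = ?rev i" and "b = ?rev i'"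
    have v: "b < a" "a < e" "e < c" "c < d" "d < n"
      using lt E \<open>i' < n\<close> unfolding a_def b_def E2_def U_def by auto
    have "(p a - p b) \<bullet> (p d - p b) < 0"
    proof (rule obtuse_angle_right)
      show "dist (p a) (p e) = 1" "dist (p a) (p c) = 1" "dist (p b) (p e) = 1" "dist (p b) (p d) = 1"
        using E unfolding a_def b_def E2_def U_def by auto
      show "ccw (p e) (p a) (p b) < 0" "ccw (p e) (p b) (p d) < 0" "ccw (p e) (p d) (p c) < 0"
        "ccw (p e) (p a) (p d) < 0" "ccw (p e) (p a) (p c) < 0"
        using v ccw_neg[of b a e] ccw_neg[of b e d] ccw_neg[of e c d] ccw_neg[of a e d]
          ccw_neg[of a e c] by (auto simp: ccw_def algebra_simps)
    qed
    moreover have "?acute b d a" using E(4) v unfolding b_def E2_def by auto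
    ultimately show False by simp
  qed
  moreover have "inj_on (\<lambda>(i, j). (?rev i, j)) E2"
    unfolding E2_def U_def inj_on_def by auto
  ultimately have c2: "real (card E2) \<le> real n * log 2 (real n) + 2 * real n"
    by (simp add: card_image)
  have "unit_distance_edges P \<subseteq> (\<lambda>(i, j). {p i, p j}) ` U"
  proof
    fix f assume "f \<in> unit_distance_edges P"
    then obtain x y where xy: "f = {x, y}" "x \<in> P" "y \<in> P" "dist x y = 1"
      unfolding unit_distance_edges_def by blast
    then obtain i j where ij: "x = p i" "y = p j" "i < n" "j < n"
      using bij unfolding bij_betw_def by blast
    have "i \<noteq> j" using xy(4) ij by auto
    then have "(i, j) \<in> U \<or> (j, i) \<in> U"
      using ij xy(4) unfolding U_def by (auto simp: dist_commute)
    then show "f \<in> (\<lambda>(i, j). {p i, p j}) ` U"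
      using ij xy(1) by (force simp: insert_commute)
  qed
  then have "card (unit_distance_edges P) \<le> card U"
    using finU by (meson card_image_le card_mono finite_imageI le_trans)
  also have "\<dots> \<le> card E1 + card E2" unfolding U12 by (rule card_Un_le)
  \<comment> \<open>The linear term 4n is twice the 2n discarded entries allowed in each
    matrix.\<close>
  finally show ?thesis using c1 c2 unfolding n_def by linarith
qed

theorem theorem4p3:
  shows "\<exists>C::real. \<forall>P::(real^2) set. finite P \<longrightarrow> card P \<ge> 2 \<longrightarrow> convexly_independent P \<longrightarrow>
           real (card (unit_distance_edges P)) \<le> 2 * real (card P) * log 2 (real (card P)) + C * real (card P)"
  using card_unit_distance_edges_le by (intro exI[of _ 4]) auto

end
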